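(* Let $\mathcal G=(G_n,\|\cdot\|_n)_{n\in\mathbb N}$ be a family of metric groups (norms with values in $[0,\infty]$, not assumed bounded), let $\mathcal U$ be a non-principal ultrafilter on $\mathbb N$, and let $\{X_m\}_{m\in\mathbb N}$ be a countable family of metrically internal subsets of $\mathcal G^*_{\mathrm{met}}$, where $X_m=\frac{\prod_{n\in\mathbb N}X_{m,n}}{\mathcal E}$ with $X_{m,n}\subseteq G_n$. The following conditions are equivalent. (1) $\mathcal G^*_{\mathrm{met,fin}}\subseteq\bigcup_{m\in\mathbb N}X_m$. (2) For every $t>0$ and any infinite sequence of positive reals $(\varepsilon_0,\varepsilon_1,\ldots)$ there is $N\in\mathbb N$ such that $(\varepsilon_0,\varepsilon_1,\ldots,\varepsilon_N)$ has the following property: for $\mathcal U$-almost all $n\in\mathbb N$, $$B_t(e)\subseteq X_{0,n}\,B_{\varepsilon_0}(e)\cup\ldots\cup X_{N,n}\,B_{\varepsilon_N}(e)\quad\text{holds in }G_n.$$ (3) For every $t>0$ and any infinite sequence of positive reals $(\varepsilon_0,\varepsilon_1,\ldots)$ there is $N\in\mathbb N$ such that $$B_t(e)\subseteq X_0\,B_{\varepsilon_0}(e)\cup\ldots\cup X_N\,B_{\varepsilon_N}(e)\quad\text{holds in }\mathcal G^*_{\mathrm{met,fin}}.$$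
   Context: A metric group $(G,\|\cdot\|)$ is a group with a bi-invariant norm $\|\cdot\|\colon G\to[0,\infty]$: $\|e\|=0$, $\|gh\|\le\|g\|+\|h\|$, $\|g^{-1}\|=\|g\|=\|hgh^{-1}\|$, and $\|g\|=0$ iff $g=e$. $B_\varepsilon(e)=\{h : \|h\|<\varepsilon\}$, computed in the group indicated. The metric ultraproduct is $\mathcal G^*_{\mathrm{met}}=\prod_{n}G_n/\mathcal E$, where $\mathcal E=\{(g_n)\in\prod_n G_n : \lim_{n\to\mathcal U}\|g_n\|_n=0\}$ is the subgroup of infinitesimals, with norm $\|(g_n)/\mathcal E\|=\lim_{n\to\mathcal U}\|g_n\|_n\in[0,\infty]$. Its finitary subgroup is $\mathcal G^*_{\mathrm{met,fin}}=\{x\in\mathcal G^*_{\mathrm{met}} : \|x\|<\infty\}$. For $Y_n\subseteq G_n$, $\frac{\prod_n Y_n}{\mathcal E}$ denotes the image of $\prod_nY_n$ in $\mathcal G^*_{\mathrm{met}}$; a subset of $\mathcal G^*_{\mathrm{met}}$ is metrically internal if it is of this form. "For $\mathcal U$-almost all $n$" means for a set of $n$ belonging to $\mathcal U$. Products of subsets are elementwise products.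
   Formalization: Added assumption: for each m, if some X_{m,n} is empty then X_{m,n} is empty for U-almost all n; otherwise the claim fails (X_{m,0} empty, X_{m,n}=G_n for n≥1 gives all X_m empty, so (2) holds but (1) and (3) fail). *)

theory Defs
  imports "HOL-Analysis.Analysis" "HOL-Algebra.Product_Groups"
begin

locale metric_group = group G for G (structure) +
  fixes nrm :: "'a \<Rightarrow> ennreal"
  assumes nrm_one: "nrm \<one> = 0"
    and nrm_mult_le: "\<lbrakk>g \<in> carrier G; h \<in> carrier G\<rbrakk> \<Longrightarrow> nrm (g \<otimes> h) \<le> nrm g + nrm h"
    and nrm_inv: "g \<in> carrier G \<Longrightarrow> nrm (inv g) = nrm g"
    and nrm_conj: "\<lbrakk>g \<in> carrier G; h \<in> carrier G\<rbrakk> \<Longrightarrow> nrm (h \<otimes> g \<otimes> inv h) = nrm g"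
    and nrm_zero_iff: "g \<in> carrier G \<Longrightarrow> nrm g = 0 \<longleftrightarrow> g = \<one>"

definition norm_ball :: "('a, 'b) monoid_scheme \<Rightarrow> ('a \<Rightarrow> ennreal) \<Rightarrow> real \<Rightarrow> 'a set"
  where "norm_ball G nrm \<epsilon> = {h \<in> carrier G. nrm h < ennreal \<epsilon>}"

text \<open>Ultrafilters are represented by filters in the sense of the library:
  a set \<open>A\<close> belongs to \<open>U\<close> iff \<open>eventually (\<lambda>n. n \<in> A) U\<close>.\<close>

definition is_ultrafilter :: "'i filter \<Rightarrow> bool"
  where "is_ultrafilter U \<longleftrightarrow>
    U \<noteq> bot \<and> (\<forall>P. eventually P U \<or> eventually (\<lambda>n. \<not> P n) U)"

definition nonprincipal_ultrafilter :: "'i filter \<Rightarrow> bool"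
  where "nonprincipal_ultrafilter U \<longleftrightarrow>
    is_ultrafilter U \<and> (\<forall>n. \<not> eventually (\<lambda>k. k = n) U)"

definition lim_norm :: "'i filter \<Rightarrow> ('i \<Rightarrow> 'a \<Rightarrow> ennreal) \<Rightarrow> ('i \<Rightarrow> 'a) \<Rightarrow> ennreal"
  where "lim_norm U nrm g = Lim U (\<lambda>n. nrm n (g n))"

definition infinitesimals ::
    "'i filter \<Rightarrow> ('i \<Rightarrow> ('a, 'b) monoid_scheme) \<Rightarrow> ('i \<Rightarrow> 'a \<Rightarrow> ennreal) \<Rightarrow> ('i \<Rightarrow> 'a) set"
  where "infinitesimals U G nrm =
    {g \<in> carrier (product_group UNIV G). lim_norm U nrm g = 0}"

definition metric_ultraproduct ::
    "'i filter \<Rightarrow> ('i \<Rightarrow> ('a, 'b) monoid_scheme) \<Rightarrow> ('i \<Rightarrow> 'a \<Rightarrow> ennreal) \<Rightarrow> ('i \<Rightarrow> 'a) set monoid"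
  where "metric_ultraproduct U G nrm = product_group UNIV G Mod infinitesimals U G nrm"

text \<open>Elements of the ultraproduct are cosets, on which \<^const>\<open>lim_norm\<close> is constant
  (lemma \<open>ultraproduct_norm_coset\<close> below).\<close>

definition ultraproduct_norm ::
    "'i filter \<Rightarrow> ('i \<Rightarrow> 'a \<Rightarrow> ennreal) \<Rightarrow> ('i \<Rightarrow> 'a) set \<Rightarrow> ennreal"
  where "ultraproduct_norm U nrm x = the_elem (lim_norm U nrm ` x)"

definition finitary_ultraproduct ::
    "'i filter \<Rightarrow> ('i \<Rightarrow> ('a, 'b) monoid_scheme) \<Rightarrow> ('i \<Rightarrow> 'a \<Rightarrow> ennreal) \<Rightarrow> ('i \<Rightarrow> 'a) set monoid"
  where "finitary_ultraproduct U G nrm = (metric_ultraproduct U G nrm)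
    \<lparr>carrier := {x \<in> carrier (metric_ultraproduct U G nrm). ultraproduct_norm U nrm x < \<infinity>}\<rparr>"

text \<open>The image of \<open>\<Prod>\<^sub>n Y n\<close> in the ultraproduct. It is empty as soon as a single \<open>Y n\<close> is.\<close>

definition internal_set ::
    "'i filter \<Rightarrow> ('i \<Rightarrow> ('a, 'b) monoid_scheme) \<Rightarrow> ('i \<Rightarrow> 'a \<Rightarrow> ennreal) \<Rightarrow> ('i \<Rightarrow> 'a set)
      \<Rightarrow> ('i \<Rightarrow> 'a) set set"
  where "internal_set U G nrm Y =
    (\<lambda>g. infinitesimals U G nrm #>\<^bsub>product_group UNIV G\<^esub> g) ` (\<Pi>\<^sub>E n\<in>UNIV. Y n)"

lemma is_ultrafilter_tendsto_Lim:
  fixes f :: "'i \<Rightarrow> ennreal"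
  assumes "is_ultrafilter U"
  shows "(f \<longlongrightarrow> Lim U f) U"
proof -
  have U: "U \<noteq> bot" and ult: "\<And>P. eventually P U \<or> eventually (\<lambda>n. \<not> P n) U"
    using assms by (auto simp: is_ultrafilter_def)
  have ne: "filtermap f U \<noteq> bot"
    using U by (simp add: filtermap_bot_iff)
  obtain l where l: "inf (nhds l) (filtermap f U) \<noteq> bot"
    using compact_UNIV[where 'a = ennreal] ne unfolding compact_filter by auto
  have "(f \<longlongrightarrow> l) U"
  proof (rule topological_tendstoI)
    fix S :: "ennreal set" assume S: "open S" "l \<in> S"
    show "eventually (\<lambda>x. f x \<in> S) U"
    proof (rule ccontr)
      assume "\<not> ?thesis"
      with ult have "eventually (\<lambda>x. \<not> f x \<in> S) U" by blast
      then have "eventually (\<lambda>y. y \<notin> S) (filtermap f U)" by (simp add: eventually_filtermap)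
      moreover have "eventually (\<lambda>y. y \<in> S) (nhds l)" using S by (rule eventually_nhds_in_open)
      ultimately have "eventually (\<lambda>_. False) (inf (nhds l) (filtermap f U))"
        unfolding eventually_inf by blast
      with l show False by (simp add: trivial_limit_def)
    qed
  qed
  with U show ?thesis by (metis tendsto_Lim)
qed

context
  fixes U :: "'i filter" and G :: "'i \<Rightarrow> ('a, 'b) monoid_scheme" and nrm :: "'i \<Rightarrow> 'a \<Rightarrow> ennreal"
  assumes U: "is_ultrafilter U"
    and G: "\<And>n. metric_group (G n) (nrm n)"
begin

interpretation G: metric_group "G n" "nrm n" for n by (rule G)

interpretation P: group "product_group UNIV G" by (simp add: G.is_group)

lemma tendsto_lim_norm: "((\<lambda>n. nrm n (g n)) \<longlongrightarrow> lim_norm U nrm g) U"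
  unfolding lim_norm_def by (rule is_ultrafilter_tendsto_Lim[OF U])

lemma lim_norm_eqI: "((\<lambda>n. nrm n (g n)) \<longlongrightarrow> l) U \<Longrightarrow> lim_norm U nrm g = l"
  unfolding lim_norm_def using U by (intro tendsto_Lim) (auto simp: is_ultrafilter_def)

lemma lim_norm_mult_le:
  assumes "g \<in> carrier (product_group UNIV G)" "h \<in> carrier (product_group UNIV G)"
  shows "lim_norm U nrm (g \<otimes>\<^bsub>product_group UNIV G\<^esub> h) \<le> lim_norm U nrm g + lim_norm U nrm h"
proof (rule tendsto_le[OF _ tendsto_add[OF tendsto_lim_norm tendsto_lim_norm] tendsto_lim_norm])
  show "U \<noteq> bot" using U by (simp add: is_ultrafilter_def)
  show "\<forall>\<^sub>F n in U. nrm n ((g \<otimes>\<^bsub>product_group UNIV G\<^esub> h) n) \<le> nrm n (g n) + nrm n (h n)"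
    using assms by (intro always_eventually) (auto simp: PiE_iff intro: G.nrm_mult_le)
qed

lemma lim_norm_inv:
  assumes "g \<in> carrier (product_group UNIV G)"
  shows "lim_norm U nrm (inv\<^bsub>product_group UNIV G\<^esub> g) = lim_norm U nrm g"
  using assms by (simp add: lim_norm_def G.is_group G.nrm_inv PiE_iff)

lemma lim_norm_conj:
  assumes "g \<in> carrier (product_group UNIV G)" "h \<in> carrier (product_group UNIV G)"
  shows "lim_norm U nrm
    (h \<otimes>\<^bsub>product_group UNIV G\<^esub> g \<otimes>\<^bsub>product_group UNIV G\<^esub> inv\<^bsub>product_group UNIV G\<^esub> h) = lim_norm U nrm g"
  using assms by (simp add: lim_norm_def G.is_group G.nrm_conj PiE_iff)

lemma normal_infinitesimals: "infinitesimals U G nrm \<lhd> product_group UNIV G"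
proof (rule P.normal_invI)
  show "subgroup (infinitesimals U G nrm) (product_group UNIV G)"
  proof (rule P.subgroupI)
    have "lim_norm U nrm \<one>\<^bsub>product_group UNIV G\<^esub> = 0"
      by (rule lim_norm_eqI) (simp add: G.nrm_one)
    then show "infinitesimals U G nrm \<noteq> {}"
      using P.one_closed unfolding infinitesimals_def by blast
    show "a \<otimes>\<^bsub>product_group UNIV G\<^esub> b \<in> infinitesimals U G nrm"
      if "a \<in> infinitesimals U G nrm" "b \<in> infinitesimals U G nrm" for a b
    proof -
      have "a \<in> carrier (product_group UNIV G)" "b \<in> carrier (product_group UNIV G)"
          "lim_norm U nrm a = 0" "lim_norm U nrm b = 0"
        using that by (auto simp: infinitesimals_def)
      then show ?thesis
        using P.m_closed[of a b] lim_norm_mult_le[of a b]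
        by (simp add: infinitesimals_def del: mult_product_group carrier_product_group)
    qed
  qed (auto simp: infinitesimals_def lim_norm_inv simp del: inv_product_group carrier_product_group)
qed (auto simp: infinitesimals_def lim_norm_conj
          simp del: inv_product_group carrier_product_group mult_product_group)

lemma ultraproduct_norm_coset:
  assumes g: "g \<in> carrier (product_group UNIV G)"
  shows "ultraproduct_norm U nrm (infinitesimals U G nrm #>\<^bsub>product_group UNIV G\<^esub> g) = lim_norm U nrm g"
proof -
  let ?P = "product_group UNIV G"
  have "lim_norm U nrm (a \<otimes>\<^bsub>?P\<^esub> g) = lim_norm U nrm g" if "a \<in> infinitesimals U G nrm" for a
  proof (rule antisym)
    have a: "a \<in> carrier ?P" "lim_norm U nrm a = 0"
      using that by (auto simp: infinitesimals_def)
    show "lim_norm U nrm (a \<otimes>\<^bsub>?P\<^esub> g) \<le> lim_norm U nrm g"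
      using lim_norm_mult_le[OF a(1) g] a(2) by simp
    have "g = inv\<^bsub>?P\<^esub> a \<otimes>\<^bsub>?P\<^esub> (a \<otimes>\<^bsub>?P\<^esub> g)"
      using a(1) g by (metis P.inv_closed P.l_inv P.l_one P.m_assoc)
    then show "lim_norm U nrm g \<le> lim_norm U nrm (a \<otimes>\<^bsub>?P\<^esub> g)"
      using lim_norm_mult_le[OF P.inv_closed[OF a(1)] P.m_closed[OF a(1) g]] lim_norm_inv[OF a(1)] a(2)
      by (metis add_0)
  qed
  moreover have "infinitesimals U G nrm \<noteq> {}"
    using normal_infinitesimals normal_imp_subgroup subgroup.one_closed by blast
  ultimately have "lim_norm U nrm ` (infinitesimals U G nrm #>\<^bsub>?P\<^esub> g) = {lim_norm U nrm g}"
    by (force simp: r_coset_def image_UN simp del: mult_product_group)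
  then show ?thesis by (simp add: ultraproduct_norm_def)
qed

end

end

theory Submission
  imports Defs
begin

text \<open>Since \<open>\<parallel>y\<inverse>g\<parallel>\<close> measures the distance from \<open>g\<close> to \<open>y\<close>, the set \<open>X\<^sub>i B\<^sub>\<epsilon>\<close> is the open
  \<open>\<epsilon>\<close>-neighbourhood of \<open>X\<^sub>i\<close>. If (2) fails for \<open>t\<close> and \<open>\<epsilon>\<close>, countable saturation of \<open>U\<close> yields one
  sequence \<open>g\<close> of norm at most \<open>t\<close> that almost everywhere avoids every \<open>Y\<^sub>i B\<^sub>\<epsilon>\<^sub>i\<close>, so \<open>g\<close> lies in
  no \<open>X\<^sub>m\<close>. Condition (2) for \<open>\<epsilon> / 2\<close> gives (3) for \<open>\<epsilon>\<close>, because an ultrafilter picks one of finitely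
  many alternatives. Finally internal sets are closed, again by saturation, so a point outside all
  \<open>X\<^sub>m\<close> avoids \<open>X\<^sub>m B\<^sub>\<epsilon>\<^sub>m\<close> for suitable \<open>\<epsilon>\<^sub>m\<close>, which contradicts (3).\<close>

section \<open>Ultrafilters and countable saturation\<close>

lemma ultrafilter_not_eventually:
  assumes "is_ultrafilter U"
  shows "\<not> eventually P U \<longleftrightarrow> eventually (\<lambda>n. \<not> P n) U"
proof
  assume "eventually (\<lambda>n. \<not> P n) U"
  show "\<not> eventually P U"
  proof
    assume "eventually P U"
    with \<open>eventually (\<lambda>n. \<not> P n) U\<close> have "eventually (\<lambda>_. False) U"
      by eventually_elim simp
    with assms show False by (simp add: is_ultrafilter_def)
  qed
qed (use assms in \<open>auto simp: is_ultrafilter_def\<close>)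

text \<open>If every alternative failed almost everywhere, finiteness of \<open>I\<close> would make
  them all fail together almost everywhere.\<close>

lemma ultrafilter_eventually_bex_finite:
  assumes "is_ultrafilter U" "finite I" "\<forall>\<^sub>F n in U. \<exists>i\<in>I. P i n"
  shows "\<exists>i\<in>I. eventually (P i) U"
proof (rule ccontr)
  assume "\<not> ?thesis"
  then have "\<forall>i\<in>I. \<forall>\<^sub>F n in U. \<not> P i n"
    using assms(1) by (simp add: ultrafilter_not_eventually)
  then have "\<forall>\<^sub>F n in U. \<forall>i\<in>I. \<not> P i n"
    using assms(2) by (simp add: eventually_ball_finite)
  then have "\<not> (\<forall>\<^sub>F n in U. \<exists>i\<in>I. P i n)"
    using assms(1) by (simp add: ultrafilter_not_eventually)
  with assms(3) show False by contradiction
qed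

lemma nonprincipal_ultrafilter_eventually_ge:
  fixes U :: "nat filter"
  assumes "nonprincipal_ultrafilter U"
  shows "\<forall>\<^sub>F n in U. k \<le> n"
proof -
  have "\<forall>j\<in>{..<k}. \<forall>\<^sub>F n in U. n \<noteq> j"
    using assms by (auto simp: nonprincipal_ultrafilter_def ultrafilter_not_eventually)
  then have "\<forall>\<^sub>F n in U. \<forall>j\<in>{..<k}. n \<noteq> j"
    by (simp add: eventually_ball_finite)
  then show ?thesis
    by (rule eventually_mono) (auto intro: leI)
qed

text \<open>Diagonal choice: at coordinate \<open>n\<close>, satisfy the longest satisfiable initial
  segment of conditions with index at most \<open>n\<close>. Almost every \<open>n\<close> is at
  least any fixed \<open>k\<close>, so each condition is met almost everywhere.\<close>

lemma nonprincipal_ultrafilter_saturation: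
  fixes U :: "nat filter" and S :: "nat \<Rightarrow> 'a set" and P :: "nat \<Rightarrow> nat \<Rightarrow> 'a \<Rightarrow> bool"
  assumes U: "nonprincipal_ultrafilter U"
    and S: "\<And>n. S n \<noteq> {}"
    and ev: "\<And>k. \<forall>\<^sub>F n in U. \<exists>y\<in>S n. \<forall>i\<le>k. P i n y"
  shows "\<exists>f\<in>Pi UNIV S. \<forall>k. \<forall>\<^sub>F n in U. P k n (f n)"
proof -
  \<comment> \<open>The cut-off \<open>k \<le> n\<close> keeps \<open>A n\<close> finite even if all
    conditions are satisfiable; a witness for \<open>Max (A n)\<close> then serves all of
    \<open>A n\<close>.\<close>
  define A where "A = (\<lambda>n. {k. k \<le> n \<and> (\<exists>y\<in>S n. \<forall>i\<le>k. P i n y)})"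
  have "\<exists>y\<in>S n. \<forall>k\<in>A n. P k n y" for n
  proof (cases "A n = {}")
    case True
    with S[of n] show ?thesis by auto
  next
    case False
    have fin: "finite (A n)" by (simp add: A_def)
    with False have "Max (A n) \<in> A n" by (rule Max_in[rotated])
    then obtain y where "y \<in> S n" "\<forall>i\<le>Max (A n). P i n y" by (auto simp: A_def)
    with fin show ?thesis by (meson Max_ge)
  qed
  then obtain f where f: "\<And>n. f n \<in> S n" "\<And>n k. k \<in> A n \<Longrightarrow> P k n (f n)" by metis
  have "\<forall>\<^sub>F n in U. P k n (f n)" for k
    using ev[of k] nonprincipal_ultrafilter_eventually_ge[OF U, of k]
    by eventually_elim (rule f(2), simp add: A_def)
  with f(1) show ?thesis by blast
qed

section \<open>Neighbourhoods in a metric group\<close>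

lemma (in metric_group) mem_set_mult_norm_ball_iff:
  assumes "A \<subseteq> carrier G" "g \<in> carrier G"
  shows "g \<in> A <#> norm_ball G nrm \<epsilon> \<longleftrightarrow> (\<exists>y\<in>A. nrm (inv y \<otimes> g) < ennreal \<epsilon>)"
proof
  assume "g \<in> A <#> norm_ball G nrm \<epsilon>"
  then obtain y h where h: "y \<in> A" "h \<in> carrier G" "nrm h < ennreal \<epsilon>" "g = y \<otimes> h"
    by (auto simp: set_mult_def norm_ball_def)
  then have "inv y \<otimes> g = h" using assms by (auto simp: subset_iff simp flip: m_assoc)
  with h(1,3) show "\<exists>y\<in>A. nrm (inv y \<otimes> g) < ennreal \<epsilon>" by blast
next
  assume "\<exists>y\<in>A. nrm (inv y \<otimes> g) < ennreal \<epsilon>"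
  then obtain y where y: "y \<in> A" "nrm (inv y \<otimes> g) < ennreal \<epsilon>" by blast
  then have y': "y \<in> carrier G" using assms(1) by blast
  with assms(2) have "y \<otimes> (inv y \<otimes> g) = g" by (simp flip: m_assoc)
  moreover have "inv y \<otimes> g \<in> norm_ball G nrm \<epsilon>"
    using y(2) y' assms(2) by (simp add: norm_ball_def)
  ultimately show "g \<in> A <#> norm_ball G nrm \<epsilon>" using y(1) unfolding set_mult_def by force
qed

section \<open>Cosets and limit distances in the ultraproduct\<close>

context
  fixes U :: "'i filter" and G :: "'i \<Rightarrow> ('a, 'b) monoid_scheme" and nrm :: "'i \<Rightarrow> 'a \<Rightarrow> ennreal"
  assumes U: "is_ultrafilter U"
    and G: "\<And>n. metric_group (G n) (nrm n)"
begin

interpretation G: metric_group "G n" "nrm n" for n by (rule G)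

interpretation P: group "product_group UNIV G" by (simp add: G.is_group)

interpretation E: normal "infinitesimals U G nrm" "product_group UNIV G"
  by (rule normal_infinitesimals[OF U G])

lemma lim_norm_less_eventually:
  "lim_norm U nrm g < c \<Longrightarrow> \<forall>\<^sub>F n in U. nrm n (g n) < c"
  by (rule order_tendstoD(2)[OF tendsto_lim_norm[OF U G]])

lemma lim_norm_le:
  "\<forall>\<^sub>F n in U. nrm n (g n) \<le> c \<Longrightarrow> lim_norm U nrm g \<le> c"
  using U by (intro tendsto_upperbound[OF tendsto_lim_norm[OF U G]]) (auto simp: is_ultrafilter_def)

text \<open>Coset algebra takes place in the product group, saturation in the coordinates; this is
  the bridge between them.\<close>

lemma lim_norm_inv_mult:
  assumes "y \<in> carrier (product_group UNIV G)"
  shows "lim_norm U nrm (inv\<^bsub>product_group UNIV G\<^esub> y \<otimes>\<^bsub>product_group UNIV G\<^esub> g)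
    = lim_norm U nrm (\<lambda>n. inv\<^bsub>G n\<^esub> y n \<otimes>\<^bsub>G n\<^esub> g n)"
  using assms by (simp add: lim_norm_def G.is_group PiE_iff)

lemma carrier_metric_ultraproduct:
  "carrier (metric_ultraproduct U G nrm) =
    (\<lambda>g. infinitesimals U G nrm #>\<^bsub>product_group UNIV G\<^esub> g) ` carrier (product_group UNIV G)"
  by (auto simp: metric_ultraproduct_def FactGroup_def RCOSETS_def)

lemma carrier_finitary_ultraproduct:
  "carrier (finitary_ultraproduct U G nrm) =
    (\<lambda>g. infinitesimals U G nrm #>\<^bsub>product_group UNIV G\<^esub> g) `
      {g \<in> carrier (product_group UNIV G). lim_norm U nrm g < \<infinity>}"
  by (auto simp: finitary_ultraproduct_def carrier_metric_ultraproduct ultraproduct_norm_coset[OF U G]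
      simp del: carrier_product_group)

text \<open>The radius \<open>ennreal t\<close> is finite, so the finiteness requirement of the
  finitary subgroup is absorbed by the ball.\<close>

lemma norm_ball_finitary_ultraproduct:
  "norm_ball (finitary_ultraproduct U G nrm) (ultraproduct_norm U nrm) t =
    (\<lambda>g. infinitesimals U G nrm #>\<^bsub>product_group UNIV G\<^esub> g) `
      {g \<in> carrier (product_group UNIV G). lim_norm U nrm g < ennreal t}"
proof -
  have "c < ennreal t \<Longrightarrow> c < \<infinity>" for c
    using order_less_trans[of c "ennreal t" \<infinity>] by simp
  then show ?thesis
    by (auto simp: norm_ball_def carrier_finitary_ultraproduct ultraproduct_norm_coset[OF U G]
      simp del: carrier_product_group)
qed

text \<open>By normality the right coset of \<open>y\<close> is also its left coset, which puts the
  inverse of \<open>y\<close> to the left of \<open>g\<close>, the form used for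
  neighbourhoods.\<close>

lemma coset_infinitesimals_eq_iff:
  assumes "g \<in> carrier (product_group UNIV G)" "y \<in> carrier (product_group UNIV G)"
  shows "infinitesimals U G nrm #>\<^bsub>product_group UNIV G\<^esub> g = infinitesimals U G nrm #>\<^bsub>product_group UNIV G\<^esub> y
    \<longleftrightarrow> lim_norm U nrm (inv\<^bsub>product_group UNIV G\<^esub> y \<otimes>\<^bsub>product_group UNIV G\<^esub> g) = 0"
proof -
  let ?P = "product_group UNIV G" and ?c = "\<lambda>x. infinitesimals U G nrm #>\<^bsub>product_group UNIV G\<^esub> x"
  have "?c g = ?c y \<longleftrightarrow> g \<in> y <#\<^bsub>?P\<^esub> infinitesimals U G nrm"
    using E.coset_eq assms P.repr_independence P.rcos_self E.subgroup_axioms by metis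
  also have "\<dots> \<longleftrightarrow> inv\<^bsub>?P\<^esub> y \<otimes>\<^bsub>?P\<^esub> g \<in> infinitesimals U G nrm"
  proof
    assume "g \<in> y <#\<^bsub>?P\<^esub> infinitesimals U G nrm"
    then obtain a where a: "a \<in> infinitesimals U G nrm" "g = y \<otimes>\<^bsub>?P\<^esub> a"
      unfolding l_coset_def by blast
    then have "inv\<^bsub>?P\<^esub> y \<otimes>\<^bsub>?P\<^esub> g = a"
      using assms E.mem_carrier P.inv_solve_left by metis
    with a(1) show "inv\<^bsub>?P\<^esub> y \<otimes>\<^bsub>?P\<^esub> g \<in> infinitesimals U G nrm" by simp
  next
    assume "inv\<^bsub>?P\<^esub> y \<otimes>\<^bsub>?P\<^esub> g \<in> infinitesimals U G nrm"
    then show "g \<in> y <#\<^bsub>?P\<^esub> infinitesimals U G nrm"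
      using E.lcos_module_rev[OF P.is_group assms(2,1)] by blast
  qed
  finally show ?thesis
    unfolding infinitesimals_def using P.m_closed[OF P.inv_closed[OF assms(2)] assms(1)] by blast
qed

text \<open>Cosets agree exactly when their representatives are at limit distance zero, and over
  \<open>UNIV\<close> extensional choice functions are plain ones.\<close>

lemma coset_mem_internal_set_iff:
  assumes Y: "\<And>n. Y n \<subseteq> carrier (G n)" and g: "g \<in> carrier (product_group UNIV G)"
  shows "infinitesimals U G nrm #>\<^bsub>product_group UNIV G\<^esub> g \<in> internal_set U G nrm Y
    \<longleftrightarrow> (\<exists>y\<in>Pi UNIV Y. lim_norm U nrm (\<lambda>n. inv\<^bsub>G n\<^esub> y n \<otimes>\<^bsub>G n\<^esub> g n) = 0)"
proof -
  have "y \<in> carrier (product_group UNIV G)" if "y \<in> Pi UNIV Y" for y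
    using that Y by (auto simp: PiE_iff Pi_iff)
  then show ?thesis
    unfolding internal_set_def image_iff PiE_UNIV_domain
    by (intro bex_cong refl) (simp only: coset_infinitesimals_eq_iff[OF g] lim_norm_inv_mult)
qed

text \<open>The ball factor \<open>b\<close> is determined up to an infinitesimal as the inverse of
  \<open>y\<close> times \<open>g\<close>, and infinitesimals do not change the limit norm. Hence
  the strict bound survives with the same \<open>\<epsilon>\<close>.\<close>

lemma coset_mem_internal_set_mult_norm_ball_iff:
  assumes Y: "\<And>n. Y n \<subseteq> carrier (G n)" and g: "g \<in> carrier (product_group UNIV G)"
  shows "infinitesimals U G nrm #>\<^bsub>product_group UNIV G\<^esub> g \<in>
      internal_set U G nrm Y <#>\<^bsub>finitary_ultraproduct U G nrm\<^esub>
        norm_ball (finitary_ultraproduct U G nrm) (ultraproduct_norm U nrm) \<epsilon>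
    \<longleftrightarrow> (\<exists>y\<in>Pi UNIV Y. lim_norm U nrm (\<lambda>n. inv\<^bsub>G n\<^esub> y n \<otimes>\<^bsub>G n\<^esub> g n) < ennreal \<epsilon>)"
    (is "?c g \<in> ?XB \<longleftrightarrow> ?R")
proof -
  let ?P = "product_group UNIV G"
  have sub: "y \<in> carrier ?P" if "y \<in> Pi UNIV Y" for y
    using that Y by (auto simp: PiE_iff Pi_iff)
  \<comment> \<open>Passing to the finitary subgroup changes only the carrier, so products are those
    of the full quotient. This matters because internal sets may contain elements of infinite
    norm.\<close>
  have set_mult: "x \<in> A <#>\<^bsub>finitary_ultraproduct U G nrm\<^esub> B \<longleftrightarrow> (\<exists>a\<in>A. \<exists>b\<in>B. x = a <#>\<^bsub>?P\<^esub> b)" for x A B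
    unfolding set_mult_def[of "finitary_ultraproduct U G nrm"]
    by (simp add: finitary_ultraproduct_def metric_ultraproduct_def FactGroup_def)
  have "?c g \<in> ?XB \<longleftrightarrow> (\<exists>y\<in>Pi UNIV Y. \<exists>b\<in>carrier ?P. lim_norm U nrm b < ennreal \<epsilon> \<and>
      ?c g = ?c y <#>\<^bsub>?P\<^esub> ?c b)"
    unfolding set_mult norm_ball_finitary_ultraproduct internal_set_def PiE_UNIV_domain
    by (simp only: bex_simps) (simp only: Bex_def conj_assoc)
  also have "\<dots> \<longleftrightarrow> (\<exists>y\<in>Pi UNIV Y. \<exists>b\<in>carrier ?P. lim_norm U nrm b < ennreal \<epsilon> \<and>
      ?c g = ?c (y \<otimes>\<^bsub>?P\<^esub> b))"
    using sub by (simp add: E.rcos_sum del: carrier_product_group mult_product_group cong: conj_cong)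
  also have "\<dots> \<longleftrightarrow> (\<exists>y\<in>Pi UNIV Y. lim_norm U nrm (inv\<^bsub>?P\<^esub> y \<otimes>\<^bsub>?P\<^esub> g) < ennreal \<epsilon>)"
  proof (intro bex_cong refl iffI)
    fix y assume "y \<in> Pi UNIV Y"
    then have y: "y \<in> carrier ?P" by (rule sub)
    {
      assume "\<exists>b\<in>carrier ?P. lim_norm U nrm b < ennreal \<epsilon> \<and> ?c g = ?c (y \<otimes>\<^bsub>?P\<^esub> b)"
      then obtain b where b: "b \<in> carrier ?P" "lim_norm U nrm b < ennreal \<epsilon>" "?c g = ?c (y \<otimes>\<^bsub>?P\<^esub> b)"
        by blast
      have iy: "inv\<^bsub>?P\<^esub> y \<in> carrier ?P" using y by (rule P.inv_closed)
      \<comment> \<open>Multiplying by the coset of the inverse of \<open>y\<close> cancels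
        \<open>y\<close> modulo infinitesimals.\<close>
      have "?c (inv\<^bsub>?P\<^esub> y \<otimes>\<^bsub>?P\<^esub> g) = ?c (inv\<^bsub>?P\<^esub> y) <#>\<^bsub>?P\<^esub> ?c g"
        by (rule E.rcos_sum[OF iy g, symmetric])
      also have "\<dots> = ?c (inv\<^bsub>?P\<^esub> y \<otimes>\<^bsub>?P\<^esub> (y \<otimes>\<^bsub>?P\<^esub> b))"
        unfolding b(3) by (rule E.rcos_sum[OF iy P.m_closed[OF y b(1)]])
      also have "inv\<^bsub>?P\<^esub> y \<otimes>\<^bsub>?P\<^esub> (y \<otimes>\<^bsub>?P\<^esub> b) = b"
        by (metis P.l_inv P.l_one P.m_assoc b(1) iy y)
      finally have "ultraproduct_norm U nrm (?c (inv\<^bsub>?P\<^esub> y \<otimes>\<^bsub>?P\<^esub> g)) = ultraproduct_norm U nrm (?c b)"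
        by (rule arg_cong)
      then have "lim_norm U nrm (inv\<^bsub>?P\<^esub> y \<otimes>\<^bsub>?P\<^esub> g) = lim_norm U nrm b"
        unfolding ultraproduct_norm_coset[where G = G, OF U G P.m_closed[OF iy g]]
          ultraproduct_norm_coset[where G = G, OF U G b(1)] .
      with b(2) show "lim_norm U nrm (inv\<^bsub>?P\<^esub> y \<otimes>\<^bsub>?P\<^esub> g) < ennreal \<epsilon>" by simp
    next
      assume "lim_norm U nrm (inv\<^bsub>?P\<^esub> y \<otimes>\<^bsub>?P\<^esub> g) < ennreal \<epsilon>"
      moreover have "g = y \<otimes>\<^bsub>?P\<^esub> (inv\<^bsub>?P\<^esub> y \<otimes>\<^bsub>?P\<^esub> g)"
        by (metis P.inv_closed P.l_one P.m_assoc P.r_inv g y)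
      ultimately show "\<exists>b\<in>carrier ?P. lim_norm U nrm b < ennreal \<epsilon> \<and> ?c g = ?c (y \<otimes>\<^bsub>?P\<^esub> b)"
        using P.m_closed[OF P.inv_closed[OF y] g] by metis
    }
  qed
  also have "\<dots> \<longleftrightarrow> ?R"
    by (intro bex_cong refl) (simp only: lim_norm_inv_mult[OF sub])
  finally show ?thesis .
qed

end

theorem theorem2p8:
  fixes G :: "nat \<Rightarrow> ('a, 'b) monoid_scheme"
    and nrm :: "nat \<Rightarrow> 'a \<Rightarrow> ennreal"
    and U :: "nat filter"
    and Y :: "nat \<Rightarrow> nat \<Rightarrow> 'a set"
    and X :: "nat \<Rightarrow> (nat \<Rightarrow> 'a) set set"
  assumes metric_groups: "\<And>n. metric_group (G n) (nrm n)"
    and U: "nonprincipal_ultrafilter U"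
    and Y_sub: "\<And>m n. Y m n \<subseteq> carrier (G n)"
    (* Without this the equivalence fails: if Y m n = {} for n = 0 only, then X m = {},
       although condition (2) does not see the coordinate n = 0. *)
    and Y_empty: "\<And>m. (\<exists>n. Y m n = {}) \<Longrightarrow> (\<forall>\<^sub>F n in U. Y m n = {})"
    and X: "\<And>m. X m = internal_set U G nrm (Y m)"
  shows
    "(carrier (finitary_ultraproduct U G nrm) \<subseteq> (\<Union>m. X m)
      \<longleftrightarrow>
      (\<forall>t::real. t > 0 \<longrightarrow> (\<forall>\<epsilon>::nat \<Rightarrow> real. (\<forall>i. \<epsilon> i > 0) \<longrightarrow>
        (\<exists>N. \<forall>\<^sub>F n in U.
          norm_ball (G n) (nrm n) t
            \<subseteq> (\<Union>i\<le>N. Y i n <#>\<^bsub>G n\<^esub> norm_ball (G n) (nrm n) (\<epsilon> i))))))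
     \<and>
     ((\<forall>t::real. t > 0 \<longrightarrow> (\<forall>\<epsilon>::nat \<Rightarrow> real. (\<forall>i. \<epsilon> i > 0) \<longrightarrow>
        (\<exists>N. \<forall>\<^sub>F n in U.
          norm_ball (G n) (nrm n) t
            \<subseteq> (\<Union>i\<le>N. Y i n <#>\<^bsub>G n\<^esub> norm_ball (G n) (nrm n) (\<epsilon> i)))))
      \<longleftrightarrow>
      (\<forall>t::real. t > 0 \<longrightarrow> (\<forall>\<epsilon>::nat \<Rightarrow> real. (\<forall>i. \<epsilon> i > 0) \<longrightarrow>
        (\<exists>N. norm_ball (finitary_ultraproduct U G nrm) (ultraproduct_norm U nrm) t
            \<subseteq> (\<Union>i\<le>N. X i <#>\<^bsub>finitary_ultraproduct U G nrm\<^esub>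
                norm_ball (finitary_ultraproduct U G nrm) (ultraproduct_norm U nrm) (\<epsilon> i))))))"
proof -
  interpret G: metric_group "G n" "nrm n" for n by (rule metric_groups)
  have ult: "is_ultrafilter U" using U by (simp add: nonprincipal_ultrafilter_def)
  let ?P = "product_group UNIV G"
  let ?L = "lim_norm U nrm"
  let ?d = "\<lambda>y g. ?L (\<lambda>n. inv\<^bsub>G n\<^esub> y n \<otimes>\<^bsub>G n\<^esub> g n)"
  note lim_less = lim_norm_less_eventually[where G = G and nrm = nrm, OF ult metric_groups]
  note lim_le = lim_norm_le[where G = G and nrm = nrm, OF ult metric_groups]
  have P: "g \<in> carrier ?P \<longleftrightarrow> (\<forall>n. g n \<in> carrier (G n))" for g
    by (simp add: PiE_iff)
  \<comment> \<open>\<open>C1\<close>, \<open>C2\<close> and \<open>C3\<close> rephrase the three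
    conditions by representatives and distances; a cycle of implications among them yields both
    equivalences.\<close>
  define C1 where "C1 \<longleftrightarrow> (\<forall>g\<in>carrier ?P. ?L g < \<infinity> \<longrightarrow> (\<exists>m. \<exists>y\<in>Pi UNIV (Y m). ?d y g = 0))"
  define C2 where "C2 \<longleftrightarrow> (\<forall>t>0. \<forall>\<epsilon>. (\<forall>i. \<epsilon> i > 0) \<longrightarrow> (\<exists>N. \<forall>\<^sub>F n in U.
    \<forall>g\<in>carrier (G n). nrm n g < ennreal t \<longrightarrow>
      (\<exists>i\<le>N. \<exists>y\<in>Y i n. nrm n (inv\<^bsub>G n\<^esub> y \<otimes>\<^bsub>G n\<^esub> g) < ennreal (\<epsilon> i))))"
  define C3 where "C3 \<longleftrightarrow> (\<forall>t>0. \<forall>\<epsilon>. (\<forall>i. \<epsilon> i > 0) \<longrightarrow> (\<exists>N.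
    \<forall>g\<in>carrier ?P. ?L g < ennreal t \<longrightarrow>
      (\<exists>i\<le>N. \<exists>y\<in>Pi UNIV (Y i). ?d y g < ennreal (\<epsilon> i))))"
  have C1_iff: "carrier (finitary_ultraproduct U G nrm) \<subseteq> (\<Union>m. X m) \<longleftrightarrow> C1"
    unfolding C1_def carrier_finitary_ultraproduct[where G = G and nrm = nrm, OF ult metric_groups]
    by (simp add: image_subset_iff X Ball_def imp_conjL
        coset_mem_internal_set_iff[where G = G and nrm = nrm, OF ult metric_groups Y_sub]
        del: carrier_product_group)
  have ball2: "norm_ball (G n) (nrm n) t \<subseteq> (\<Union>i\<le>N. Y i n <#>\<^bsub>G n\<^esub> norm_ball (G n) (nrm n) (\<epsilon> i))
    \<longleftrightarrow> (\<forall>g\<in>carrier (G n). nrm n g < ennreal t \<longrightarrow>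
      (\<exists>i\<le>N. \<exists>y\<in>Y i n. nrm n (inv\<^bsub>G n\<^esub> y \<otimes>\<^bsub>G n\<^esub> g) < ennreal (\<epsilon> i)))" for n t N \<epsilon>
    unfolding subset_iff norm_ball_def[of _ _ t]
    by (simp add: G.mem_set_mult_norm_ball_iff[OF Y_sub] Ball_def Bex_def imp_conjL)
  have ball3: "norm_ball (finitary_ultraproduct U G nrm) (ultraproduct_norm U nrm) t
            \<subseteq> (\<Union>i\<le>N. X i <#>\<^bsub>finitary_ultraproduct U G nrm\<^esub>
                norm_ball (finitary_ultraproduct U G nrm) (ultraproduct_norm U nrm) (\<epsilon> i))
    \<longleftrightarrow> (\<forall>g\<in>carrier ?P. ?L g < ennreal t \<longrightarrow>
      (\<exists>i\<le>N. \<exists>y\<in>Pi UNIV (Y i). ?d y g < ennreal (\<epsilon> i)))" for t N \<epsilon>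
    unfolding norm_ball_finitary_ultraproduct[where G = G and nrm = nrm and t = t, OF ult metric_groups]
    by (simp add: image_subset_iff X coset_mem_internal_set_mult_norm_ball_iff
          [where G = G and nrm = nrm, OF ult metric_groups Y_sub] del: carrier_product_group)
      (simp only: Ball_def Bex_def atMost_iff imp_conjL)

  \<comment> \<open>From (1) to (2): a sequence avoiding every neighbourhood\<close>
  have "C2" if C1
  proof (rule ccontr)
    assume "\<not> C2"
    then obtain t \<epsilon> where t: "t > 0" and \<epsilon>: "\<And>i. \<epsilon> i > 0"
      and neg: "\<And>N. \<not> (\<forall>\<^sub>F n in U. \<forall>g\<in>carrier (G n). nrm n g < ennreal t \<longrightarrow>
        (\<exists>i\<le>N. \<exists>y\<in>Y i n. nrm n (inv\<^bsub>G n\<^esub> y \<otimes>\<^bsub>G n\<^esub> g) < ennreal (\<epsilon> i)))"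
      unfolding C2_def by blast
    \<comment> \<open>The norm bound is repeated in the condition for each \<open>i\<close>, so that
      one application of saturation controls both norm and avoidance.\<close>
    have "\<exists>g\<in>Pi UNIV (\<lambda>n. carrier (G n)). \<forall>i. \<forall>\<^sub>F n in U. nrm n (g n) < ennreal t \<and>
        (\<forall>y\<in>Y i n. \<not> nrm n (inv\<^bsub>G n\<^esub> y \<otimes>\<^bsub>G n\<^esub> g n) < ennreal (\<epsilon> i))"
    proof (rule nonprincipal_ultrafilter_saturation[OF U])
      show "carrier (G n) \<noteq> {}" for n using G.one_closed by blast
      show "\<forall>\<^sub>F n in U. \<exists>g\<in>carrier (G n). \<forall>i\<le>k. nrm n g < ennreal t \<and>
        (\<forall>y\<in>Y i n. \<not> nrm n (inv\<^bsub>G n\<^esub> y \<otimes>\<^bsub>G n\<^esub> g) < ennreal (\<epsilon> i))" for k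
        using neg[of k] unfolding ultrafilter_not_eventually[OF ult]
        by (rule eventually_mono) blast
    qed
    then obtain g where g: "g \<in> carrier ?P"
      and g_t: "\<forall>\<^sub>F n in U. nrm n (g n) < ennreal t"
      and avoid: "\<And>i. \<forall>\<^sub>F n in U. \<forall>y\<in>Y i n. \<not> nrm n (inv\<^bsub>G n\<^esub> y \<otimes>\<^bsub>G n\<^esub> g n) < ennreal (\<epsilon> i)"
      unfolding eventually_conj_iff P by blast
    have "?L g \<le> ennreal t" using g_t by (intro lim_le) (auto elim: eventually_mono)
    then have "?L g < \<infinity>" using order_le_less_trans by fastforce
    with \<open>C1\<close> g obtain m y where y: "y \<in> Pi UNIV (Y m)" "?d y g = 0"
      unfolding C1_def by blast
    \<comment> \<open>Limit distance zero puts \<open>g n\<close> within \<open>\<epsilon> m\<close>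
      of \<open>y n\<close> almost everywhere, against the avoidance of the neighbourhood with index
      \<open>m\<close>.\<close>
    have "\<forall>\<^sub>F n in U. nrm n (inv\<^bsub>G n\<^esub> y n \<otimes>\<^bsub>G n\<^esub> g n) < ennreal (\<epsilon> m)"
      using \<epsilon>[of m] y(2) by (intro lim_less) simp
    with avoid[of m] have "\<forall>\<^sub>F n in U. False"
      by eventually_elim (use y(1) in auto)
    with ult show False by (simp add: is_ultrafilter_def)
  qed

  \<comment> \<open>From (2) to (3): choosing one index for almost all coordinates\<close>
  moreover have "C3" if C2
    unfolding C3_def
  proof (intro allI impI)
    fix t :: real and \<epsilon> :: "nat \<Rightarrow> real"
    assume t: "t > 0" and \<epsilon>: "\<forall>i. \<epsilon> i > 0"
    \<comment> \<open>A strict bound may become an equality in the limit; halving leaves room for a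
      strict bound by \<open>\<epsilon> i\<close>.\<close>
    then have half: "\<epsilon> i / 2 > 0" for i by simp
    from \<open>C2\<close>[unfolded C2_def, rule_format, OF t, of "\<lambda>i. \<epsilon> i / 2", OF half]
    obtain N where N: "\<forall>\<^sub>F n in U. \<forall>g\<in>carrier (G n). nrm n g < ennreal t \<longrightarrow>
        (\<exists>i\<le>N. \<exists>y\<in>Y i n. nrm n (inv\<^bsub>G n\<^esub> y \<otimes>\<^bsub>G n\<^esub> g) < ennreal (\<epsilon> i / 2))"
      by blast
    have "\<exists>i\<le>N. \<exists>y\<in>Pi UNIV (Y i). ?d y g < ennreal (\<epsilon> i)"
      if g: "g \<in> carrier ?P" "?L g < ennreal t" for g
    proof -
      \<comment> \<open>Here \<open>i\<close> still depends on \<open>n\<close>; the ultrafilter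
        then selects a single index among the finitely many.\<close>
      have "\<forall>\<^sub>F n in U. \<exists>i\<in>{..N}. \<exists>y\<in>Y i n. nrm n (inv\<^bsub>G n\<^esub> y \<otimes>\<^bsub>G n\<^esub> g n) < ennreal (\<epsilon> i / 2)"
        using N lim_less[OF g(2)] by eventually_elim (use g(1)[unfolded P] in \<open>auto simp: Bex_def\<close>)
      from ultrafilter_eventually_bex_finite[OF ult finite_atMost this]
      obtain i where i: "i \<le> N"
        "\<forall>\<^sub>F n in U. \<exists>y\<in>Y i n. nrm n (inv\<^bsub>G n\<^esub> y \<otimes>\<^bsub>G n\<^esub> g n) < ennreal (\<epsilon> i / 2)"
        by auto
      then have "\<forall>\<^sub>F n in U. Y i n \<noteq> {}" by (auto elim: eventually_mono)
      \<comment> \<open>One empty \<open>Y i n\<close> would by \<open>Y_empty\<close> force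
        emptiness almost everywhere. Nonemptiness at every coordinate is what a choice function
        needs.\<close>
      then have ne: "Y i n \<noteq> {}" for n
        using Y_empty[of i] ultrafilter_not_eventually[OF ult, of "\<lambda>n. Y i n = {}"] by blast
      \<comment> \<open>The implication makes the choice total: a near point where there is one, an
        arbitrary point of \<open>Y i n\<close> elsewhere.\<close>
      then have "\<exists>y\<in>Y i n. (\<exists>y\<in>Y i n. nrm n (inv\<^bsub>G n\<^esub> y \<otimes>\<^bsub>G n\<^esub> g n) < ennreal (\<epsilon> i / 2)) \<longrightarrow>
          nrm n (inv\<^bsub>G n\<^esub> y \<otimes>\<^bsub>G n\<^esub> g n) < ennreal (\<epsilon> i / 2)" for n
        by blast
      then obtain y where y: "\<And>n. y n \<in> Y i n"
        "\<And>n. \<exists>y\<in>Y i n. nrm n (inv\<^bsub>G n\<^esub> y \<otimes>\<^bsub>G n\<^esub> g n) < ennreal (\<epsilon> i / 2) \<Longrightarrow>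
          nrm n (inv\<^bsub>G n\<^esub> y n \<otimes>\<^bsub>G n\<^esub> g n) < ennreal (\<epsilon> i / 2)"
        by metis
      have "?d y g \<le> ennreal (\<epsilon> i / 2)"
        using i(2) by (intro lim_le) (auto elim!: eventually_mono dest!: y(2))
      also have "\<dots> < ennreal (\<epsilon> i)" using \<epsilon> by (simp add: ennreal_less_iff less_imp_le)
      finally show ?thesis using i(1) y(1) by blast
    qed
    then show "\<exists>N. \<forall>g\<in>carrier ?P. ?L g < ennreal t \<longrightarrow>
        (\<exists>i\<le>N. \<exists>y\<in>Pi UNIV (Y i). ?d y g < ennreal (\<epsilon> i))"
      by blast
  qed

  \<comment> \<open>From (3) to (1): closedness of internal sets\<close>
  moreover have "C1" if C3
    unfolding C1_def
  proof (intro ballI impI, rule ccontr)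
    fix g assume g: "g \<in> carrier ?P" "?L g < \<infinity>"
      and notin: "\<nexists>m. \<exists>y\<in>Pi UNIV (Y m). ?d y g = 0"
    have "\<exists>\<delta>>0. \<forall>y\<in>Pi UNIV (Y m). \<not> ?d y g < ennreal \<delta>" for m
    proof (rule ccontr)
      assume "\<not> ?thesis"
      then have close: "\<exists>y\<in>Pi UNIV (Y m). ?d y g < ennreal \<delta>" if "\<delta> > 0" for \<delta>
        using that by blast
      \<comment> \<open>Approximants within \<open>inverse (real (Suc k))\<close> for each
        \<open>k\<close> are glued into one \<open>y\<close> at limit distance zero, which
        \<open>notin\<close> forbids.\<close>
      have "\<exists>y\<in>Pi UNIV (Y m). \<forall>k. \<forall>\<^sub>F n in U.
          nrm n (inv\<^bsub>G n\<^esub> y n \<otimes>\<^bsub>G n\<^esub> g n) < ennreal (inverse (real (Suc k)))"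
      proof (rule nonprincipal_ultrafilter_saturation[OF U])
        show "Y m n \<noteq> {}" for n using close[of 1] by fastforce
        fix k
        obtain y where y: "y \<in> Pi UNIV (Y m)" "?d y g < ennreal (inverse (real (Suc k)))"
          using close[of "inverse (real (Suc k))"] by auto
        \<comment> \<open>Saturation asks for all bounds up to \<open>k\<close> at once; they
          decrease, so the last one implies the others.\<close>
        have mono: "ennreal (inverse (real (Suc k))) \<le> ennreal (inverse (real (Suc i)))" if "i \<le> k" for i
          using that by (intro ennreal_leI le_imp_inverse_le) auto
        from lim_less[OF y(2)] show "\<forall>\<^sub>F n in U. \<exists>y\<in>Y m n. \<forall>i\<le>k.
            nrm n (inv\<^bsub>G n\<^esub> y \<otimes>\<^bsub>G n\<^esub> g n) < ennreal (inverse (real (Suc i)))"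
          by (rule eventually_mono) (use y(1) in \<open>blast intro: order_less_le_trans[OF _ mono]\<close>)
      qed
      then obtain y where y: "y \<in> Pi UNIV (Y m)"
        "\<And>k. \<forall>\<^sub>F n in U. nrm n (inv\<^bsub>G n\<^esub> y n \<otimes>\<^bsub>G n\<^esub> g n) < ennreal (inverse (real (Suc k)))"
        by blast
      have "?d y g \<le> ennreal (inverse (real (Suc k)))" for k
        using y(2)[of k] by (intro lim_le) (auto elim: eventually_mono)
      moreover have "(\<lambda>k. ennreal (inverse (real (Suc k)))) \<longlonglongrightarrow> ennreal 0"
        by (intro tendsto_ennrealI LIMSEQ_inverse_real_of_nat)
      ultimately have "?d y g \<le> ennreal 0"
        by (intro LIMSEQ_le_const) auto
      with y(1) notin show False by auto
    qed
    then obtain \<epsilon> where \<epsilon>: "\<And>m. \<epsilon> m > 0" "\<And>m y. y \<in> Pi UNIV (Y m) \<Longrightarrow> \<not> ?d y g < ennreal (\<epsilon> m)"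
      by metis
    \<comment> \<open>The radius \<open>r + 1\<close> is positive even for \<open>r = 0\<close> and
      puts \<open>g\<close> inside the open ball; the separating \<open>\<epsilon>\<close> then
      contradicts \<open>C3\<close>.\<close>
    obtain r where r: "r \<ge> 0" "?L g = ennreal r" using g(2) by (cases "?L g") auto
    then have "?L g < ennreal (r + 1)" by (simp add: ennreal_less_iff)
    moreover have "r + 1 > 0" using r(1) by simp
    ultimately show False using \<open>C3\<close> \<epsilon> g(1) unfolding C3_def by blast
  qed
  ultimately have eqs: "C1 \<longleftrightarrow> C2" "C2 \<longleftrightarrow> C3" by blast+
  show ?thesis
    unfolding C1_iff ball2 ball3 C2_def[symmetric] C3_def[symmetric]
    using eqs by blast
qed

end
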